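(* Let $\sigma$ be a finite nonempty signature of atoms. The class $\mathcal Q_p^\sigma[\mathsf U]$ is exponentially characterisable within $\mathcal Q_p^\sigma[\mathsf U]$; that is, there is a polynomial $p$ such that every $q\in\mathcal Q_p^\sigma[\mathsf U]$ is uniquely characterised within $\mathcal Q_p^\sigma[\mathsf U]$ by some example set $E$ with $|E|\le 2^{p(|q|)}$.
   Context: A $\sigma$-data instance is a finite sequence $\mathcal D=(\delta_0,\dots,\delta_n)$ with $\delta_i\subseteq\sigma$, identified with its extensions by trailing $\emptyset$'s (so $\delta_\ell=\emptyset$ for $\ell>n$); $|\mathcal D|=\sum_i|\delta_i|$. Semantics at $\ell\in\mathbb N$: $\mathcal D,\ell\models A$ iff $A\in\delta_\ell$; $\mathcal D,\ell\models\top$; $\mathcal D,\ell\not\models\bot$; conjunction as usual; $\mathcal D,\ell\models q_1\mathbin{\mathsf U}q_2$ iff there is $m>\ell$ with $\mathcal D,m\models q_2$ and $\mathcal D,k\models q_1$ for all $k$ with $\ell<k<m$. Queries are equivalent ($q\equiv q'$) if they are true at the same $(\mathcal D,\ell)$. $|q|$ is the number of symbols in $q$. $\mathcal Q_p^\sigma[\mathsf U]$ is the class of queries $q=\rho_0\wedge(\lambda_1\mathbin{\mathsf U}(\rho_1\wedge(\lambda_2\mathbin{\mathsf U}(\dots(\lambda_n\mathbin{\mathsf U}\rho_n)\dots))))$, $n\ge0$, where each $\rho_i$ is a (possibly empty) conjunction of atoms from $\sigma$ and each $\lambda_i$ is either $\bot$ or a (possibly empty) conjunction of atoms from $\sigma$;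 the empty conjunction is $\top$. An example set is a pair $E=(E^+,E^-)$ of finite sets of $\sigma$-data instances, $|E|=\sum_{\mathcal D\in E^+\cup E^-}|\mathcal D|$. A query $q$ fits $E$ if $\mathcal D,0\models q$ for all $\mathcal D\in E^+$ and $\mathcal D,0\not\models q$ for all $\mathcal D\in E^-$. $E$ uniquely characterises $q$ within a class $\mathcal Q$ if $q$ fits $E$ and $q\equiv q'$ for all $q'\in\mathcal Q$ that fit $E$. *)

theory Defs
  imports "HOL-Computational_Algebra.Polynomial"
begin

(* Finite sequences of subsets of sig, up to trailing empty sets, are represented
   canonically as eventually empty functions on the natural numbers. *)
definition data_instances :: "'a set \<Rightarrow> (nat \<Rightarrow> 'a set) set" where
  "data_instances sig = {D. (\<forall>l. D l \<subseteq> sig) \<and> finite {l. D l \<noteq> {}}}"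

definition instance_size :: "(nat \<Rightarrow> 'a set) \<Rightarrow> nat" where
  "instance_size D = (\<Sum>l | D l \<noteq> {}. card (D l))"

datatype 'a query =
    Atom 'a
  | Top
  | Bot
  | And "'a query" "'a query"
  | Until "'a query" "'a query"

(* Strict until: neither argument is evaluated at the current time point. *)
primrec sat :: "(nat \<Rightarrow> 'a set) \<Rightarrow> nat \<Rightarrow> 'a query \<Rightarrow> bool" where
  "sat D l (Atom A) \<longleftrightarrow> A \<in> D l"
| "sat D l Top \<longleftrightarrow> True"
| "sat D l Bot \<longleftrightarrow> False"
| "sat D l (And q1 q2) \<longleftrightarrow> sat D l q1 \<and> sat D l q2"
| "sat D l (Until q1 q2) \<longleftrightarrow>
     (\<exists>m>l. sat D m q2 \<and> (\<forall>k. l < k \<and> k < m \<longrightarrow> sat D k q1))"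

primrec query_size :: "'a query \<Rightarrow> nat" where
  "query_size (Atom A) = 1"
| "query_size Top = 1"
| "query_size Bot = 1"
| "query_size (And q1 q2) = query_size q1 + 1 + query_size q2"
| "query_size (Until q1 q2) = query_size q1 + 1 + query_size q2"

definition query_equiv :: "'a set \<Rightarrow> 'a query \<Rightarrow> 'a query \<Rightarrow> bool" where
  "query_equiv sig q q' \<longleftrightarrow> (\<forall>D\<in>data_instances sig. \<forall>l. sat D l q \<longleftrightarrow> sat D l q')"

fun atom_conj :: "'a list \<Rightarrow> 'a query" where
  "atom_conj [] = Top"
| "atom_conj [A] = Atom A"
| "atom_conj (A # B # As) = And (Atom A) (atom_conj (B # As))"

definition atom_conjs :: "'a set \<Rightarrow> 'a query set" where
  "atom_conjs sig = atom_conj ` lists sig"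

(* The class of queries
   rho_0 & (lambda_1 U (rho_1 & (lambda_2 U (... (lambda_n U rho_n) ...)))), n >= 0. *)
inductive_set path_queries :: "'a set \<Rightarrow> 'a query set" for sig :: "'a set" where
  last: "r \<in> atom_conjs sig \<Longrightarrow> r \<in> path_queries sig"
| step: "r \<in> atom_conjs sig \<Longrightarrow> lam \<in> insert Bot (atom_conjs sig) \<Longrightarrow>
    q \<in> path_queries sig \<Longrightarrow> And r (Until lam q) \<in> path_queries sig"

type_synonym 'a examples = "(nat \<Rightarrow> 'a set) set \<times> (nat \<Rightarrow> 'a set) set"

definition example_set :: "'a set \<Rightarrow> 'a examples \<Rightarrow> bool" where
  "example_set sig E \<longleftrightarrow> finite (fst E) \<and> finite (snd E) \<and>
     fst E \<subseteq> data_instances sig \<and> snd E \<subseteq> data_instances sig"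

definition example_size :: "'a examples \<Rightarrow> nat" where
  "example_size E = (\<Sum>D\<in>fst E \<union> snd E. instance_size D)"

definition fits :: "'a query \<Rightarrow> 'a examples \<Rightarrow> bool" where
  "fits q E \<longleftrightarrow> (\<forall>D\<in>fst E. sat D 0 q) \<and> (\<forall>D\<in>snd E. \<not> sat D 0 q)"

definition uniquely_characterises ::
    "'a set \<Rightarrow> 'a examples \<Rightarrow> 'a query \<Rightarrow> 'a query set \<Rightarrow> bool" where
  "uniquely_characterises sig E q Q \<longleftrightarrow>
     fits q E \<and> (\<forall>q'\<in>Q. fits q' E \<longrightarrow> query_equiv sig q q')"

end

theory Submission
  imports Defs
begin

text \<open>
  Dropping trailing conjuncts \<open>\<lambda> U \<top>\<close>, which are always true, every path query has a normal form
  whose last conjunction is non-empty. A normal form satisfied by the instance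
  \<open>\<sigma>, \<dots>, \<sigma>\<close> of length \<open>|q| + 1\<close> has depth at most \<open>|q|\<close>, so this one positive
  example leaves only exponentially many candidates. The truth values at \<open>l\<close> of the subqueries of
  two queries are determined by the letter at \<open>l\<close> and the truth values at \<open>l + 1\<close>; hence cutting out
  the segment between two positions with the same truth values shows that inequivalent candidates
  are separated by an instance of exponential length. One such instance per candidate suffices.
\<close>

section \<open>Strict until: offset form, one-step recursion, invariance under shifts\<close>

lemma sat_Until_iff:
  "sat D l (Until a b) \<longleftrightarrow> (\<exists>k. sat D (Suc (l + k)) b \<and> (\<forall>k'<k. sat D (Suc (l + k')) a))"
  (is "?L \<longleftrightarrow> ?R")
proof
  assume ?L
  then obtain m where m: "l < m" "sat D m b" "\<And>k. l < k \<Longrightarrow> k < m \<Longrightarrow> sat D k a"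
    by auto
  from less_imp_Suc_add[OF m(1)] obtain k where "m = Suc (l + k)" by blast
  with m show ?R by (intro exI[of _ k]) auto
next
  assume ?R
  then obtain k where k: "sat D (Suc (l + k)) b" "\<And>k'. k' < k \<Longrightarrow> sat D (Suc (l + k')) a"
    by auto
  have "sat D j a" if "l < j" "j < Suc (l + k)" for j
    using less_imp_Suc_add[OF that(1)] that(2) k(2) by auto
  with k(1) show ?L unfolding sat.simps by (intro exI[of _ "Suc (l + k)"]) auto
qed

text \<open>The first candidate for a witness is \<open>Suc l\<close>, where the guard condition is
  vacuous; a later witness requires the guard at \<open>Suc l\<close> and also serves there. Since
  until is strict, nothing on the right looks at \<open>l\<close> itself.\<close>

lemma sat_Until_unfold:
  "sat D l (Until a b) \<longleftrightarrow>
     sat D (Suc l) b \<or> (sat D (Suc l) a \<and> sat D (Suc l) (Until a b))"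
  (is "?L \<longleftrightarrow> ?R")
proof
  assume ?L
  then obtain m where m: "l < m" "sat D m b" "\<And>k. l < k \<Longrightarrow> k < m \<Longrightarrow> sat D k a"
    by auto
  show ?R
  proof (cases "m = Suc l")
    case False
    with m(1) have "Suc l < m" by simp
    with m have "sat D (Suc l) (Until a b)" by (auto intro!: exI[of _ m])
    with m(3) \<open>Suc l < m\<close> show ?thesis by blast
  qed (use m in auto)
next
  assume ?R
  then show ?L
  proof
    assume "sat D (Suc l) b"
    then show ?thesis by auto
  next
    assume *: "sat D (Suc l) a \<and> sat D (Suc l) (Until a b)"
    then obtain m where m: "Suc l < m" "sat D m b" "\<And>k. Suc l < k \<Longrightarrow> k < m \<Longrightarrow> sat D k a"
      by auto
    have "sat D k a" if "l < k" "k < m" for k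
      using that m(3)[of k] * by (cases "k = Suc l") auto
    with m(1,2) show ?thesis unfolding sat.simps by (intro exI[of _ m]) auto
  qed
qed

text \<open>The semantics never looks back. Until moves both positions by the same offset, hence the
  induction over arbitrary \<open>i\<close> and \<open>j\<close>.\<close>

lemma sat_suffix_cong:
  "(\<And>k. D (i + k) = D' (j + k)) \<Longrightarrow> sat D i q \<longleftrightarrow> sat D' j q"
proof (induction q arbitrary: i j)
  case (Atom A)
  from Atom[of 0] show ?case by simp
next
  case (Until a b)
  have "sat D (Suc (i + k)) a \<longleftrightarrow> sat D' (Suc (j + k)) a"
    "sat D (Suc (i + k)) b \<longleftrightarrow> sat D' (Suc (j + k)) b" for k
    using Until.prems[of "Suc k + n" for n] by (auto intro!: Until.IH simp: add.assoc)
  then show ?case unfolding sat_Until_iff by simp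
next
  case (And a b)
  then show ?case by (metis sat.simps(4))
qed simp_all

section \<open>Truth values propagate backwards; shortening of instances\<close>

definition subquery_closed :: "'a query set \<Rightarrow> bool" where
  "subquery_closed F \<longleftrightarrow>
     (\<forall>a b. And a b \<in> F \<or> Until a b \<in> F \<longrightarrow> a \<in> F \<and> b \<in> F)"

text \<open>An atom reads only the current letter. By \<open>sat_Until_unfold\<close> an until
  reads, at the next position, its two arguments and itself, and all three lie in \<open>F\<close>.
  So an instance read from right to left drives a deterministic automaton whose states are subsets
  of \<open>F\<close>.\<close>

lemma sat_cong_step:
  assumes "subquery_closed F" "D i = D' j"
    and "\<And>q. q \<in> F \<Longrightarrow> sat D (Suc i) q \<longleftrightarrow> sat D' (Suc j) q"
  shows "q \<in> F \<Longrightarrow> sat D i q \<longleftrightarrow> sat D' j q"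
proof (induction q)
  case (And a b)
  then have "a \<in> F" "b \<in> F" using assms(1) unfolding subquery_closed_def by blast+
  with And.IH show ?case by simp
next
  case (Until a b)
  then have "a \<in> F" "b \<in> F" using assms(1) unfolding subquery_closed_def by blast+
  with Until.prems show ?case by (simp only: sat_Until_unfold[of _ i] sat_Until_unfold[of _ j] assms(3))
qed (use assms(2) in auto)

text \<open>Backward induction from \<open>n\<close> to 0, with \<open>sat_cong_step\<close> at each
  position.\<close>

lemma sat_cong_prefix:
  assumes "subquery_closed F" "\<And>k. k < n \<Longrightarrow> D k = D' k"
    and "\<And>q. q \<in> F \<Longrightarrow> sat D n q \<longleftrightarrow> sat D' n q"
    and "q \<in> F"
  shows "sat D 0 q \<longleftrightarrow> sat D' 0 q"
proof -
  have "\<forall>q\<in>F. sat D 0 q \<longleftrightarrow> sat D' 0 q"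
    using le0[of n]
  proof (induction rule: inc_induct)
    case (step k)
    show ?case
      using sat_cong_step[OF assms(1), of D k D' k] assms(2)[OF step.hyps(2)] step.IH by simp
  qed (use assms(3) in blast)
  with assms(4) show ?thesis by blast
qed

text \<open>There are at most \<open>2 ^ card F\<close> sets of true members of \<open>F\<close>, so
  among more positions two share such a set. Cutting out the segment between them leaves the truth
  values at 0 unchanged, and strong induction on \<open>N\<close> repeats this until the bound is
  reached.\<close>

lemma ex_short_instance:
  assumes F: "finite F" "subquery_closed F"
    and "\<And>l. D l \<subseteq> sig" "\<And>l. N \<le> l \<Longrightarrow> D l = {}"
  shows "\<exists>D'. (\<forall>l. D' l \<subseteq> sig) \<and> (\<forall>l\<ge>2 ^ card F. D' l = {}) \<and>
    (\<forall>q\<in>F. sat D' 0 q \<longleftrightarrow> sat D 0 q)"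
  using assms(3,4)
proof (induction N arbitrary: D rule: less_induct)
  case (less N)
  show ?case
  proof (cases "N \<le> 2 ^ card F")
    case True
    with less.prems show ?thesis by (intro exI[of _ D]) auto
  next
    case False
    define ty where "ty i = {q\<in>F. sat D i q}" for i
    have "ty ` {..N} \<subseteq> Pow F" by (auto simp: ty_def)
    then have "card (ty ` {..N}) \<le> 2 ^ card F"
      using F(1) by (metis card_Pow card_mono finite_Pow_iff)
    with False have "card (ty ` {..N}) < card {..N}" by simp
    then have "\<not> inj_on ty {..N}" by (rule pigeonhole)
    then obtain i j where ij: "i < j" "j \<le> N" "ty i = ty j"
      unfolding inj_on_def by (metis atMost_iff linorder_neqE_nat)
    \<comment> \<open>The letters at \<open>i\<close>, ..., \<open>j - 1\<close> are deleted, so the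
      suffix of \<open>D'\<close> from \<open>i\<close> is that of \<open>D\<close> from
      \<open>j\<close>. As \<open>j \<le> N\<close>, the emptiness bound drops by
      \<open>j - i\<close>.\<close>
    define D' where "D' k = (if k < i then D k else D (k + (j - i)))" for k
    have "sat D' 0 q \<longleftrightarrow> sat D 0 q" if "q \<in> F" for q
    proof (rule sat_cong_prefix[OF F(2) _ _ that, of i])
      fix q assume q: "q \<in> F"
      have "sat D' i q \<longleftrightarrow> sat D j q"
        by (rule sat_suffix_cong) (use ij in \<open>simp add: D'_def algebra_simps\<close>)
      also have "\<dots> \<longleftrightarrow> sat D i q" using ij(3) q by (auto simp: ty_def)
      finally show "sat D' i q \<longleftrightarrow> sat D i q" .
    qed (simp add: D'_def)
    moreover have "\<exists>D''. (\<forall>l. D'' l \<subseteq> sig) \<and> (\<forall>l\<ge>2 ^ card F. D'' l = {}) \<and>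
      (\<forall>q\<in>F. sat D'' 0 q \<longleftrightarrow> sat D' 0 q)"
    proof (rule less.IH[of "N - (j - i)"])
      show "N - (j - i) < N" using ij by simp
      show "D' l \<subseteq> sig" for l using less.prems(1) by (simp add: D'_def)
      show "D' l = {}" if "N - (j - i) \<le> l" for l
        using that ij less.prems(2) by (auto simp: D'_def)
    qed
    ultimately show ?thesis by metis
  qed
qed

lemma instance_size_le:
  assumes "finite sig" "\<And>l. D l \<subseteq> sig" "\<And>l. N \<le> l \<Longrightarrow> D l = {}"
  shows "instance_size D \<le> N * card sig"
proof -
  have "{l. D l \<noteq> {}} \<subseteq> {..<N}" using assms(3) by (auto simp: not_le[symmetric])
  then have "instance_size D \<le> (\<Sum>l<N. card (D l))"
    unfolding instance_size_def by (intro sum_mono2) auto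
  also have "\<dots> \<le> (\<Sum>l<N. card sig)" by (intro sum_mono card_mono assms)
  finally show ?thesis by simp
qed

lemma data_instances_iff:
  "D \<in> data_instances sig \<longleftrightarrow> (\<forall>l. D l \<subseteq> sig) \<and> (\<exists>N. \<forall>l\<ge>N. D l = {})"
proof -
  have "finite {l. D l \<noteq> {}} \<longleftrightarrow> (\<exists>N. \<forall>l\<ge>N. D l = {})"
    unfolding finite_nat_set_iff_bounded mem_Collect_eq Ball_def by (meson not_le)
  then show ?thesis by (auto simp: data_instances_def)
qed

section \<open>Separating two inequivalent queries by an instance of exponential length\<close>

primrec subqueries :: "'a query \<Rightarrow> 'a query set" where
  "subqueries (Atom A) = {Atom A}"
| "subqueries Top = {Top}"
| "subqueries Bot = {Bot}"
| "subqueries (And a b) = insert (And a b) (subqueries a \<union> subqueries b)"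
| "subqueries (Until a b) = insert (Until a b) (subqueries a \<union> subqueries b)"

lemma self_in_subqueries [simp]: "q \<in> subqueries q"
  by (cases q) auto

lemma finite_subqueries [simp]: "finite (subqueries q)"
  by (induction q) auto

lemma card_subqueries: "card (subqueries q) \<le> query_size q"
proof (induction q)
  case (And a b)
  then show ?case
    using card_Un_le[of "subqueries a" "subqueries b"] by (auto simp: card_insert_if)
next
  case (Until a b)
  then show ?case
    using card_Un_le[of "subqueries a" "subqueries b"] by (auto simp: card_insert_if)
qed auto

lemma subquery_closed_Un:
  "subquery_closed F \<Longrightarrow> subquery_closed G \<Longrightarrow> subquery_closed (F \<union> G)"
  unfolding subquery_closed_def by blast

text \<open>Serves \<open>And a b\<close> and \<open>Until a b\<close> at once; for both, the second
  assumption is injectivity and distinctness of constructors.\<close>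

lemma subquery_closed_insert:
  assumes "subquery_closed (subqueries a \<union> subqueries b)"
    "\<And>c d. q = And c d \<or> q = Until c d \<Longrightarrow> c = a \<and> d = b"
  shows "subquery_closed (insert q (subqueries a \<union> subqueries b))"
  unfolding subquery_closed_def
proof (intro allI impI)
  fix c d
  let ?S = "subqueries a \<union> subqueries b"
  assume "And c d \<in> insert q ?S \<or> Until c d \<in> insert q ?S"
  then consider "c = a" "d = b" | "And c d \<in> ?S \<or> Until c d \<in> ?S"
    using assms(2) by blast
  then show "c \<in> insert q ?S \<and> d \<in> insert q ?S"
  proof cases
    case 2
    then show ?thesis using assms(1) unfolding subquery_closed_def by blast
  qed simp
qed

lemma subquery_closed_subqueries: "subquery_closed (subqueries q)"
proof (induction q)
  case (And a b)
  then show ?case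
    unfolding subqueries.simps by (intro subquery_closed_insert subquery_closed_Un) auto
next
  case (Until a b)
  then show ?case
    unfolding subqueries.simps by (intro subquery_closed_insert subquery_closed_Un) auto
qed (simp_all add: subquery_closed_def)

lemma separating_instance:
  assumes "finite sig" "\<not> query_equiv sig q q'" "query_size q + query_size q' \<le> c"
  shows "\<exists>D\<in>data_instances sig.
    sat D 0 q \<noteq> sat D 0 q' \<and> instance_size D \<le> 2 ^ c * card sig"
proof -
  obtain D l where D: "D \<in> data_instances sig" "sat D l q \<noteq> sat D l q'"
    using assms(2) by (auto simp: query_equiv_def)
  obtain N where N: "\<And>l. D l \<subseteq> sig" "\<And>l. N \<le> l \<Longrightarrow> D l = {}"
    using D(1) by (auto simp: data_instances_iff)
  \<comment> \<open>Equivalence compares all positions but examples are evaluated at 0, so the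
    difference at \<open>l\<close> is shifted to 0. The set \<open>?F\<close> covers both queries,
    so shortening preserves the difference.\<close>
  let ?D = "\<lambda>k. D (l + k)" and ?F = "subqueries q \<union> subqueries q'"
  have shift: "sat ?D 0 r \<longleftrightarrow> sat D l r" for r by (rule sat_suffix_cong) simp
  have "\<exists>D'. (\<forall>l. D' l \<subseteq> sig) \<and> (\<forall>l\<ge>2 ^ card ?F. D' l = {}) \<and>
    (\<forall>r\<in>?F. sat D' 0 r \<longleftrightarrow> sat ?D 0 r)"
    by (rule ex_short_instance[of _ _ _ N])
      (simp_all add: N subquery_closed_subqueries subquery_closed_Un)
  then obtain D' where D': "\<And>l. D' l \<subseteq> sig" "\<And>l. 2 ^ card ?F \<le> l \<Longrightarrow> D' l = {}"
    "\<And>r. r \<in> ?F \<Longrightarrow> sat D' 0 r \<longleftrightarrow> sat ?D 0 r"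
    by meson
  have "card ?F \<le> c"
    using card_Un_le[of "subqueries q" "subqueries q'"] card_subqueries[of q]
      card_subqueries[of q'] assms(3) by linarith
  then have "instance_size D' \<le> 2 ^ c * card sig"
    using instance_size_le[OF assms(1) D'(1,2)]
    by (meson le_trans mult_le_mono1 one_le_numeral power_increasing)
  moreover have "sat D' 0 q \<noteq> sat D' 0 q'" using D'(3)[of q] D'(3)[of q'] shift D(2) by auto
  moreover have "D' \<in> data_instances sig" using D'(1,2) by (auto simp: data_instances_iff)
  ultimately show ?thesis by blast
qed

section \<open>Normal forms of path queries\<close>

definition set_conj :: "'a set \<Rightarrow> 'a query" where
  "set_conj R = atom_conj (SOME xs. set xs = R \<and> distinct xs)"

lemma sat_atom_conj: "sat D l (atom_conj xs) \<longleftrightarrow> set xs \<subseteq> D l"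
  by (induction xs rule: atom_conj.induct) auto

lemma query_size_atom_conj: "query_size (atom_conj xs) \<le> 2 * length xs + 1"
  by (induction xs rule: atom_conj.induct) auto

text \<open>Path queries may repeat atoms, so even at bounded depth they are infinitely many. One
  enumeration without repetition per set leaves finitely many and bounds their size.\<close>

lemma
  assumes "finite R"
  shows sat_set_conj: "sat D l (set_conj R) \<longleftrightarrow> R \<subseteq> D l"
    and query_size_set_conj: "query_size (set_conj R) \<le> 2 * card R + 1"
proof -
  let ?xs = "SOME xs. set xs = R \<and> distinct xs"
  have "set ?xs = R \<and> distinct ?xs"
    using finite_distinct_list[OF assms] by (rule someI_ex)
  then show "sat D l (set_conj R) \<longleftrightarrow> R \<subseteq> D l"
    and "query_size (set_conj R) \<le> 2 * card R + 1"
    unfolding set_conj_def sat_atom_conj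
    using query_size_atom_conj[of ?xs] distinct_card[of ?xs] by auto
qed

fun guard :: "'a set option \<Rightarrow> 'a query" where
  "guard None = Bot"
| "guard (Some L) = set_conj L"

fun path_query :: "'a set \<Rightarrow> ('a set option \<times> 'a set) list \<Rightarrow> 'a query" where
  "path_query R [] = set_conj R"
| "path_query R ((L, R') # ps) = And (set_conj R) (Until (guard L) (path_query R' ps))"

definition path_steps :: "'a set \<Rightarrow> ('a set option \<times> 'a set) set" where
  "path_steps sig = insert None (Some ` Pow sig) \<times> Pow sig"

text \<open>A step adds a conjunction and a guard of at most \<open>2 * card sig + 1\<close> symbols
  each, plus one \<open>And\<close> and one \<open>Until\<close>.\<close>

lemma query_size_path_query:
  assumes "finite sig" "R \<subseteq> sig" "set ps \<subseteq> path_steps sig"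
  shows "query_size (path_query R ps) \<le> (4 * card sig + 4) * (length ps + 1)"
  using assms(2,3)
proof (induction R ps rule: path_query.induct)
  case (1 R)
  then show ?case
    using query_size_set_conj[of R] card_mono[of sig R] finite_subset[of R sig] assms(1) by simp
next
  case (2 R L R' ps)
  then have "query_size (path_query R' ps) \<le> (4 * card sig + 4) * (length ps + 1)"
    by (auto simp: path_steps_def)
  moreover have *: "query_size (set_conj S) \<le> 2 * card sig + 1" if "S \<subseteq> sig" for S
    using query_size_set_conj[of S] card_mono[of sig S] finite_subset[of S sig] assms(1) that
    by simp
  have "query_size (guard L) \<le> 2 * card sig + 1"
    using 2(3) * by (cases L) (auto simp: path_steps_def)
  ultimately show ?case using *[OF 2(2)] by (simp add: algebra_simps)
qed

text \<open>The non-empty last conjunction is what later bounds the depth: without it, vacuous steps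
  could be appended forever.\<close>

lemma path_query_normal_form:
  assumes "finite sig" "q \<in> path_queries sig"
  shows "\<exists>R ps. R \<subseteq> sig \<and> set ps \<subseteq> path_steps sig \<and> (ps \<noteq> [] \<longrightarrow> snd (last ps) \<noteq> {}) \<and>
    (\<forall>D l. sat D l q \<longleftrightarrow> sat D l (path_query R ps))"
  using assms(2)
proof induction
  case (last r)
  then obtain xs where "set xs \<subseteq> sig" "r = atom_conj xs"
    by (auto simp: atom_conjs_def)
  then show ?case
    by (intro exI[of _ "set xs"] exI[of _ "[]"]) (auto simp: sat_atom_conj sat_set_conj)
next
  case (step r lam q)
  then obtain xs where xs: "set xs \<subseteq> sig" "r = atom_conj xs"
    by (auto simp: atom_conjs_def)
  from step.IH obtain R ps where *: "R \<subseteq> sig" "set ps \<subseteq> path_steps sig"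
    "ps \<noteq> [] \<Longrightarrow> snd (List.last ps) \<noteq> {}" "\<And>D l. sat D l q \<longleftrightarrow> sat D l (path_query R ps)"
    by blast
  obtain L where L: "L \<in> insert None (Some ` Pow sig)" "\<And>D l. sat D l lam \<longleftrightarrow> sat D l (guard L)"
  proof (cases "lam = Bot")
    case True
    then show ?thesis using that[of None] by simp
  next
    case False
    with step.hyps obtain ys where "set ys \<subseteq> sig" "lam = atom_conj ys"
      by (auto simp: atom_conjs_def)
    then show ?thesis
      using that[of "Some (set ys)"] by (auto simp: sat_atom_conj sat_set_conj)
  qed
  show ?case
  proof (cases "ps = [] \<and> R = {}")
    case True
    \<comment> \<open>Here \<open>q\<close> is always true, so \<open>Suc l\<close> witnesses the
      until whatever the guard; the whole step is dropped. In the other case the new step is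
      prepended and the last conjunction stays non-empty.\<close>
    then have "sat D l (Until lam q)" for D l
      by (subst sat_Until_unfold) (simp add: *(4) sat_set_conj)
    with xs show ?thesis
      by (intro exI[of _ "set xs"] exI[of _ "[]"])
        (auto simp: sat_atom_conj sat_set_conj simp del: sat.simps(5))
  next
    case False
    with xs * L show ?thesis
      by (intro exI[of _ "set xs"] exI[of _ "(L, R) # ps"])
        (auto simp: sat_atom_conj sat_set_conj path_steps_def)
  qed
qed

section \<open>The full instance as a bound on depth\<close>

definition full_instance :: "'a set \<Rightarrow> nat \<Rightarrow> nat \<Rightarrow> 'a set" where
  "full_instance sig n l = (if l \<le> n then sig else {})"

text \<open>Every until is witnessed by the next position, where even the guard \<open>Bot\<close>
  is vacuous; each step costs one position and at least one symbol.\<close>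

lemma sat_full_instance:
  assumes "q \<in> path_queries sig"
  shows "l + query_size q \<le> n \<Longrightarrow> sat (full_instance sig n) l q"
  using assms(1)
proof (induction arbitrary: l rule: path_queries.induct)
  case (last r)
  then show ?case by (auto simp: atom_conjs_def sat_atom_conj full_instance_def)
next
  case (step r lam q)
  then have "sat (full_instance sig n) (Suc l) q" by simp
  then have "sat (full_instance sig n) l (Until lam q)" by (subst sat_Until_unfold) simp
  moreover have "sat (full_instance sig n) l r"
    using step by (auto simp: atom_conjs_def sat_atom_conj full_instance_def)
  ultimately show ?case by simp
qed

text \<open>Each until advances by at least one position, and the last conjunction, being non-empty,
  must be met at a position at most \<open>n\<close>.\<close>

lemma length_le_of_sat_full_instance:
  assumes "finite sig"
  shows "sat (full_instance sig n) l (path_query R ps) \<Longrightarrow> set ps \<subseteq> path_steps sig \<Longrightarrow>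
    ps \<noteq> [] \<Longrightarrow> snd (last ps) \<noteq> {} \<Longrightarrow> l + length ps \<le> n"
proof (induction R ps arbitrary: l rule: path_query.induct)
  case (2 R L R' ps)
  then obtain m where m: "l < m" "sat (full_instance sig n) m (path_query R' ps)" by auto
  show ?case
  proof (cases "ps = []")
    case True
    have "finite R'" using 2 assms by (auto simp: path_steps_def intro: finite_subset)
    with True m 2 have "full_instance sig n m \<noteq> {}" by (auto simp: sat_set_conj)
    with m True show ?thesis by (auto simp: full_instance_def split: if_splits)
  next
    case False
    with 2 m have "m + length ps \<le> n" by auto
    with m show ?thesis by simp
  qed
qed simp

section \<open>Counting the candidates and assembling the example set\<close>

lemma card_path_steps_lists:
  assumes "finite sig"
  shows "card {ps. set ps \<subseteq> path_steps sig \<and> length ps \<le> n} \<le> 2 ^ ((2 * card sig + 2) * n)"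
proof -
  have fin: "finite (path_steps sig)" using assms by (simp add: path_steps_def)
  \<comment> \<open>The extra 1 counts the guard \<open>None\<close>, that is, bottom.\<close>
  have "card (path_steps sig) = (2 ^ card sig + 1) * 2 ^ card sig"
    using assms by (simp add: path_steps_def card_cartesian_product card_Pow card_image)
  also have "\<dots> \<le> (2 ^ card sig + 2 ^ card sig) * 2 ^ card sig"
    by (intro mult_le_mono1 add_left_mono) simp
  also have "\<dots> = 2 ^ (2 * card sig + 1)" by (simp add: power_add mult_2 distrib_right)
  finally have c: "card (path_steps sig) \<le> 2 ^ (2 * card sig + 1)" .
  have "card {ps. set ps \<subseteq> path_steps sig \<and> length ps \<le> n} = (\<Sum>i\<le>n. card (path_steps sig) ^ i)"
    using card_lists_length_le[OF fin] .
  \<comment> \<open>All \<open>n + 1\<close> summands are bounded by the top power; the factor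
    \<open>n + 1\<close> is then absorbed by \<open>2 ^ n\<close>.\<close>
  also have "\<dots> \<le> (\<Sum>i\<le>n. (2 ^ (2 * card sig + 1)) ^ n)"
    by (intro sum_mono order_trans[OF power_mono[OF c] power_increasing]) auto
  also have "\<dots> = (n + 1) * 2 ^ ((2 * card sig + 1) * n)"
    by (simp only: sum_constant card_atMost power_mult) simp
  also have "\<dots> \<le> 2 ^ n * 2 ^ ((2 * card sig + 1) * n)"
    by (intro mult_le_mono1) (simp add: Suc_le_eq less_exp)
  also have "\<dots> = 2 ^ ((2 * card sig + 2) * n)"
    by (simp add: power_add[symmetric] algebra_simps)
  finally show ?thesis .
qed

text \<open>One separating instance is chosen per inequivalent candidate. With
  \<open>s = card sig\<close> and \<open>n = query_size q\<close>, the exponent adds up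
  \<open>s\<close> for \<open>R\<close>, \<open>(2 * s + 2) * n\<close> for the list of steps,
  \<open>n + (4 * s + 4) * (n + 1)\<close> for the length of an instance, and \<open>s\<close> for
  the size of its letters.\<close>

lemma separating_set:
  assumes "finite sig"
  shows "\<exists>T. finite T \<and> T \<subseteq> data_instances sig \<and>
    (\<Sum>D\<in>T. instance_size D) \<le> 2 ^ ((6 * card sig + 7) * query_size q + (6 * card sig + 4)) \<and>
    (\<forall>R ps. R \<subseteq> sig \<and> set ps \<subseteq> path_steps sig \<and> length ps \<le> query_size q \<longrightarrow>
      \<not> query_equiv sig q (path_query R ps) \<longrightarrow>
      (\<exists>D\<in>T. sat D 0 q \<noteq> sat D 0 (path_query R ps)))"
proof -
  let ?s = "card sig" and ?n = "query_size q"
  let ?c = "?n + (4 * ?s + 4) * (?n + 1)"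
  let ?P = "{ps. set ps \<subseteq> path_steps sig \<and> length ps \<le> ?n}"
  define C where "C = {(R, ps) \<in> Pow sig \<times> ?P. \<not> query_equiv sig q (path_query R ps)}"
  have finP: "finite ?P"
    using finite_lists_length_le[of "path_steps sig" ?n] assms by (simp add: path_steps_def)
  then have finC: "finite C"
    using assms by (intro finite_subset[of C "Pow sig \<times> ?P"]) (auto simp: C_def)
  have "card C \<le> card (Pow sig \<times> ?P)"
    unfolding C_def using finP assms by (intro card_mono) auto
  also have "\<dots> \<le> 2 ^ ?s * 2 ^ ((2 * ?s + 2) * ?n)"
    using card_path_steps_lists[OF assms] assms by (simp add: card_cartesian_product card_Pow)
  finally have cardC: "card C \<le> 2 ^ ?s * 2 ^ ((2 * ?s + 2) * ?n)" .
  have "\<forall>x\<in>C. \<exists>D. D \<in> data_instances sig \<and>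
    sat D 0 q \<noteq> sat D 0 (path_query (fst x) (snd x)) \<and> instance_size D \<le> 2 ^ ?c * ?s"
  proof
    fix x assume "x \<in> C"
    then obtain R ps where x: "x = (R, ps)" "R \<subseteq> sig" "set ps \<subseteq> path_steps sig"
      "length ps \<le> ?n" "\<not> query_equiv sig q (path_query R ps)"
      by (auto simp: C_def)
    have "query_size (path_query R ps) \<le> (4 * ?s + 4) * (length ps + 1)"
      by (rule query_size_path_query[OF assms x(2,3)])
    also have "\<dots> \<le> (4 * ?s + 4) * (?n + 1)" using x(4) by (intro mult_le_mono2) simp
    finally have "?n + query_size (path_query R ps) \<le> ?c" by simp
    from separating_instance[OF assms x(5) this]
    show "\<exists>D. D \<in> data_instances sig \<and>
      sat D 0 q \<noteq> sat D 0 (path_query (fst x) (snd x)) \<and> instance_size D \<le> 2 ^ ?c * ?s"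
      unfolding x(1) fst_conv snd_conv Bex_def .
  qed
  from bchoice[OF this] obtain f where f: "\<And>x. x \<in> C \<Longrightarrow> f x \<in> data_instances sig"
    "\<And>x. x \<in> C \<Longrightarrow> sat (f x) 0 q \<noteq> sat (f x) 0 (path_query (fst x) (snd x))"
    "\<And>x. x \<in> C \<Longrightarrow> instance_size (f x) \<le> 2 ^ ?c * ?s"
    by blast
  have "(\<Sum>D\<in>f ` C. instance_size D) \<le> (\<Sum>D\<in>f ` C. 2 ^ ?c * ?s)"
    by (rule sum_mono) (use f(3) in blast)
  also have "\<dots> = card (f ` C) * (2 ^ ?c * ?s)" by (simp only: sum_constant of_nat_id)
  also have "\<dots> \<le> card C * (2 ^ ?c * ?s)"
    using card_image_le[OF finC] by (intro mult_le_mono1) auto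
  also have "\<dots> \<le> (2 ^ ?s * 2 ^ ((2 * ?s + 2) * ?n)) * (2 ^ ?c * 2 ^ ?s)"
    using less_exp[of ?s] by (intro mult_le_mono cardC order_refl) simp
  also have "\<dots> = 2 ^ ((6 * ?s + 7) * ?n + (6 * ?s + 4))"
    unfolding power_add[symmetric] by (rule arg_cong[where f = "\<lambda>k. 2 ^ k"]) (simp add: algebra_simps)
  finally have "(\<Sum>D\<in>f ` C. instance_size D) \<le> 2 ^ ((6 * ?s + 7) * ?n + (6 * ?s + 4))" .
  moreover have "\<exists>D\<in>f ` C. sat D 0 q \<noteq> sat D 0 (path_query R ps)"
    if "R \<subseteq> sig" "set ps \<subseteq> path_steps sig" "length ps \<le> ?n"
      "\<not> query_equiv sig q (path_query R ps)" for R ps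
  proof -
    have "(R, ps) \<in> C" using that by (simp add: C_def)
    then show ?thesis using f(2) by (intro bexI[of _ "f (R, ps)"]) fastforce+
  qed
  moreover have "finite (f ` C)" "f ` C \<subseteq> data_instances sig" using finC f(1) by auto
  ultimately show ?thesis by (intro exI[of _ "f ` C"] conjI allI impI) simp_all
qed

theorem corollary10:
  fixes sig :: "'a set"
  assumes "finite sig" and "sig \<noteq> {}"
  shows "\<exists>p :: nat poly. \<forall>q \<in> path_queries sig. \<exists>E.
    example_set sig E \<and>
    uniquely_characterises sig E q (path_queries sig) \<and>
    example_size E \<le> 2 ^ poly p (query_size q)"
\<comment> \<open>The exponent of \<open>separating_set\<close> plus 1, since the full instance and
  \<open>T\<close> contribute at most \<open>2 ^ ?e\<close> each.\<close>
proof (rule exI[of _ "[:6 * card sig + 5, 6 * card sig + 7:]"], rule ballI)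
  let ?s = "card sig"
  fix q assume q: "q \<in> path_queries sig"
  let ?n = "query_size q"
  let ?e = "(6 * ?s + 7) * ?n + (6 * ?s + 4)"
  let ?D = "full_instance sig ?n"
  obtain T where T: "finite T" "T \<subseteq> data_instances sig"
    "(\<Sum>D\<in>T. instance_size D) \<le> 2 ^ ?e"
    "\<forall>R ps. R \<subseteq> sig \<and> set ps \<subseteq> path_steps sig \<and> length ps \<le> ?n \<longrightarrow>
      \<not> query_equiv sig q (path_query R ps) \<longrightarrow>
      (\<exists>D\<in>T. sat D 0 q \<noteq> sat D 0 (path_query R ps))"
    using separating_set[OF assms(1), of q] by (elim exE conjE) (rule that)
  let ?T = "insert ?D T"
  \<comment> \<open>Instances are sorted by the truth value of \<open>q\<close>, so \<open>q\<close>
    fits by construction, and a query fits iff it agrees with \<open>q\<close> at 0 on all of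
    \<open>?T\<close>.\<close>
  let ?E = "({D \<in> ?T. sat D 0 q}, {D \<in> ?T. \<not> sat D 0 q})"
  have D_sub: "?D l \<subseteq> sig" and D_empty: "Suc ?n \<le> l \<Longrightarrow> ?D l = {}" for l
    by (auto simp: full_instance_def)
  have "?D \<in> data_instances sig" using D_sub D_empty unfolding data_instances_iff by blast
  then have "example_set sig ?E" using T(1,2) by (auto simp: example_set_def)
  moreover have "uniquely_characterises sig ?E q (path_queries sig)"
    unfolding uniquely_characterises_def
  proof (intro conjI ballI impI)
    show "fits q ?E" by (auto simp: fits_def)
    fix q' assume q': "q' \<in> path_queries sig" "fits q' ?E"
    then have agree: "sat D 0 q' \<longleftrightarrow> sat D 0 q" if "D \<in> ?T" for D
      using that by (auto simp: fits_def)
    obtain R ps where nf: "R \<subseteq> sig" "set ps \<subseteq> path_steps sig" "ps \<noteq> [] \<Longrightarrow> snd (last ps) \<noteq> {}"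
      "\<And>D l. sat D l q' \<longleftrightarrow> sat D l (path_query R ps)"
      using path_query_normal_form[OF assms(1) q'(1)] by blast
    \<comment> \<open>The full instance is thus a positive example, which makes the normal form of
      \<open>q'\<close> shallow enough to be among the candidates handled by
      \<open>T\<close>.\<close>
    have "sat ?D 0 q" by (rule sat_full_instance[OF q]) simp
    then have "sat ?D 0 (path_query R ps)" using agree nf(4) by blast
    then have "length ps \<le> ?n"
      using length_le_of_sat_full_instance[OF assms(1) _ nf(2) _ nf(3)] by (cases "ps = []") force+
    with T(4) nf(1,2) have "query_equiv sig q (path_query R ps)
      \<or> (\<exists>D\<in>T. sat D 0 q \<noteq> sat D 0 (path_query R ps))" by blast
    with agree nf(4) have "query_equiv sig q (path_query R ps)" by blast
    then show "query_equiv sig q q'" by (simp add: query_equiv_def nf(4))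
  qed
  moreover have "example_size ?E \<le> 2 ^ poly [:6 * ?s + 5, 6 * ?s + 7:] ?n"
  proof -
    have "instance_size ?D \<le> Suc ?n * ?s"
      by (rule instance_size_le[OF assms(1) D_sub D_empty])
    also have "\<dots> \<le> 2 ^ ?n * 2 ^ ?s"
      by (intro mult_le_mono) (auto simp: Suc_le_eq less_imp_le)
    also have "\<dots> \<le> 2 ^ ?e"
      unfolding power_add[symmetric] by (rule power_increasing) (simp_all add: algebra_simps)
    finally have D_size: "instance_size ?D \<le> 2 ^ ?e" .
    have "example_size ?E = (\<Sum>D\<in>?T. instance_size D)"
      unfolding example_size_def by (rule sum.cong) auto
    also have "\<dots> \<le> instance_size ?D + (\<Sum>D\<in>T. instance_size D)"
      using T(1) by (cases "?D \<in> T") (simp_all add: insert_absorb)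
    also have "\<dots> \<le> 2 ^ Suc ?e" unfolding power_Suc using D_size T(3) by linarith
    finally show ?thesis by (simp add: algebra_simps)
  qed
  ultimately show "\<exists>E. example_set sig E \<and> uniquely_characterises sig E q (path_queries sig) \<and>
    example_size E \<le> 2 ^ poly [:6 * card sig + 5, 6 * card sig + 7:] ?n"
    by blast
qed

end
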